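(* Let $n,m,T\ge 1$, $A\in\mathbb{R}^{n\times n}$, $B\in\mathbb{R}^{n\times m}$ with $(A,B)$ stabilizable, and let $\ell:\mathbb{R}^n\times\mathbb{R}^m\to\mathbb{R}_+$ be the quadratic stage cost $\ell(x,u)=\begin{bmatrix}x\\ u\end{bmatrix}^\intercal L\begin{bmatrix}x\\ u\end{bmatrix}$ with $L=\begin{bmatrix}L_{xx}&L_{xu}\\ L_{xu}^\intercal&L_{uu}\end{bmatrix}$ symmetric, $L\succeq 0$ and $L_{uu}\succ 0$. Let $\beta:\mathbb{R}^{n+m}\times\mathbb{R}^{n+m}\to\mathbb{R}$ be the symmetric bilinear form associated to $\ell$. Let $(X,U,X^+)$ be a dataset of length $T$, i.e. $X\in\mathbb{R}^{n\times T}$, $U\in\mathbb{R}^{m\times T}$, $X^+=AX+BU$, with $\mathrm{rank}\begin{bmatrix}X\\ U\end{bmatrix}=n+m$, and let $\begin{bmatrix}\tilde X\\ \tilde U\end{bmatrix}\in\mathbb{R}^{(n+m)\times(n+m)}$ be a square matrix obtained by selecting $n+m$ columns of $\begin{bmatrix}X\\ U\end{bmatrix}$ such that $\mathrm{rank}\begin{bmatrix}\tilde X\\ \tilde U\end{bmatrix}=n+m$. Denote by $\begin{bmatrix}x^i\\ u^i\end{bmatrix}$, $i=1,\dots,n+m$, the columns of $\begin{bmatrix}\tilde X\\ \tilde U\end{bmatrix}$, and let $L_{X,U}$ be the symmetric $(n+m)\times(n+m)$ matrix with entries $$[L_{X,U}]_{ij}=\beta\left(\begin{bmatrix}x^i\\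 u^i\end{bmatrix},\begin{bmatrix}x^j\\ u^j\end{bmatrix}\right).$$ Then for each $(x,u)\in\mathbb{R}^n\times\mathbb{R}^m$ there exists $\alpha\in\mathbb{R}^{n+m}$ such that $$\ell(x,u)=\alpha^\intercal L_{X,U}\,\alpha .$$
   Context: Identify $\mathbb{R}^n\times\mathbb{R}^m$ with $\mathbb{R}^{n+m}$ by stacking. The symmetric bilinear form $\beta$ associated to the quadratic form $\ell$ is the one with $\ell(z)=\beta(z,z)$ for all $z$, equivalently $\beta(y,z)=\tfrac12\left(\ell(y+z)-\ell(y)-\ell(z)\right)$. *)

theory Defs
  imports "HOL-Analysis.Analysis"
begin

text \<open>
  The space \<open>\<real>\<^sup>n\<^sup>+\<^sup>m\<close> is rendered as \<open>real ^ ('n + 'm)\<close>, indexed by the disjoint sum of the two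
  index types. As the rows of a matrix are its components, \<open>stack\<close> also places one matrix on
  top of another.
\<close>

definition stack :: "'a ^ 'n \<Rightarrow> 'a ^ 'm \<Rightarrow> 'a ^ ('n + 'm)" where
  "stack x u = (\<chi> r. case r of Inl i \<Rightarrow> x $ i | Inr j \<Rightarrow> u $ j)"

definition block_matrix ::
  "'a ^ 'p ^ 'n \<Rightarrow> 'a ^ 'q ^ 'n \<Rightarrow> 'a ^ 'p ^ 'm \<Rightarrow> 'a ^ 'q ^ 'm \<Rightarrow> 'a ^ ('p + 'q) ^ ('n + 'm)" where
  "block_matrix P Q R S = stack (\<chi> i. stack (P $ i) (Q $ i)) (\<chi> j. stack (R $ j) (S $ j))"

definition select_columns :: "('k \<Rightarrow> 't) \<Rightarrow> 'a ^ 't ^ 'r \<Rightarrow> 'a ^ 'k ^ 'r" where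
  "select_columns \<sigma> M = (\<chi> i k. M $ i $ \<sigma> k)"

definition quadratic_form :: "real ^ 'n ^ 'n \<Rightarrow> real ^ 'n \<Rightarrow> real" where
  "quadratic_form M z = z \<bullet> (M *v z)"

definition positive_semidefinite :: "real ^ 'n ^ 'n \<Rightarrow> bool" where
  "positive_semidefinite M \<longleftrightarrow> transpose M = M \<and> (\<forall>z. quadratic_form M z \<ge> 0)"

definition positive_definite :: "real ^ 'n ^ 'n \<Rightarrow> bool" where
  "positive_definite M \<longleftrightarrow> transpose M = M \<and> (\<forall>z. z \<noteq> 0 \<longrightarrow> quadratic_form M z > 0)"

definition symmetric_bilinear_form_of ::
  "('a::real_vector \<Rightarrow> 'a \<Rightarrow> real) \<Rightarrow> ('a \<Rightarrow> real) \<Rightarrow> bool" where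
  "symmetric_bilinear_form_of \<beta> q \<longleftrightarrow>
     bilinear \<beta> \<and> (\<forall>y z. \<beta> y z = \<beta> z y) \<and> (\<forall>z. q z = \<beta> z z)"

definition eigenvalue :: "'a::field ^ 'n ^ 'n \<Rightarrow> 'a \<Rightarrow> bool" where
  "eigenvalue M c \<longleftrightarrow> (\<exists>v. v \<noteq> 0 \<and> M *v v = c *s v)"

text \<open>
  Stability is meant in discrete time, for \<open>x\<^sup>+ = M x\<close>: the eigenvalues of the real matrix \<open>M\<close>,
  non-real ones included, lie in the open unit disc.
\<close>

definition schur_stable :: "real ^ 'n ^ 'n \<Rightarrow> bool" where
  "schur_stable M \<longleftrightarrow> (\<forall>c::complex. eigenvalue (map_matrix complex_of_real M) c \<longrightarrow> norm c < 1)"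

definition stabilizable :: "real ^ 'n ^ 'n \<Rightarrow> real ^ 'm ^ 'n \<Rightarrow> bool" where
  "stabilizable A B \<longleftrightarrow> (\<exists>K :: real ^ 'n ^ 'm. schur_stable (A + B ** K))"

definition stage_cost :: "real ^ ('n + 'm) ^ ('n + 'm) \<Rightarrow> real ^ 'n \<Rightarrow> real ^ 'm \<Rightarrow> real" where
  "stage_cost L x u = quadratic_form L (stack x u)"

definition data_cost_matrix :: "(real ^ 'r \<Rightarrow> real ^ 'r \<Rightarrow> real) \<Rightarrow> real ^ 'k ^ 'r \<Rightarrow> real ^ 'k ^ 'k" where
  "data_cost_matrix \<beta> D = (\<chi> i j. \<beta> (column i D) (column j D))"

end

theory Submission
  imports Defs
begin

text \<open>
  The selected data vectors form a basis of the stacked space, so every stacked vector is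
  \<open>D *v \<alpha>\<close>, where \<open>D\<close> has the data vectors as columns. The matrix \<open>L\<^sub>X\<^sub>,\<^sub>U\<close> is the Gram matrix of
  \<open>\<beta>\<close> in that basis, hence it expresses \<open>\<ell>\<close> in the coordinates \<open>\<alpha>\<close>: this is the lemma
  \<open>bilinear_matrix_vector_mult_eq_data_cost_matrix\<close>, on the diagonal.
\<close>

text \<open>
  A product with \<open>D\<close> is a linear combination of the columns of \<open>D\<close>, so bilinearity reduces the
  form to its values on pairs of columns.
\<close>

lemma bilinear_matrix_vector_mult_eq_data_cost_matrix:
  fixes D :: "real ^ 'k ^ 'r" and a b :: "real ^ 'k"
  assumes "bilinear \<beta>"
  shows "\<beta> (D *v a) (D *v b) = a \<bullet> (data_cost_matrix \<beta> D *v b)"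
proof -
  have "\<beta> (D *v a) (D *v b) =
      \<beta> (\<Sum>i\<in>UNIV. a $ i *\<^sub>R column i D) (\<Sum>j\<in>UNIV. b $ j *\<^sub>R column j D)"
    by (simp add: matrix_mult_sum scalar_mult_eq_scaleR)
  also have "\<dots> = (\<Sum>i\<in>UNIV. \<Sum>j\<in>UNIV. a $ i * (b $ j * \<beta> (column i D) (column j D)))"
    by (simp add: bilinear_sum[OF assms] bilinear_lmul[OF assms] bilinear_rmul[OF assms]
        sum.cartesian_product mult.left_commute)
  also have "\<dots> = a \<bullet> (data_cost_matrix \<beta> D *v b)"
    by (simp add: data_cost_matrix_def inner_vec_def matrix_vector_mult_def sum_distrib_left
        mult.commute)
  finally show ?thesis .
qed

theorem proposition2:
  fixes A :: "real ^ 'n ^ 'n" and B :: "real ^ 'm ^ 'n"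
    and L :: "real ^ ('n + 'm) ^ ('n + 'm)"
    and Lxx :: "real ^ 'n ^ 'n" and Lxu :: "real ^ 'm ^ 'n" and Luu :: "real ^ 'm ^ 'm"
    and \<beta> :: "real ^ ('n + 'm) \<Rightarrow> real ^ ('n + 'm) \<Rightarrow> real"
    and X Xplus :: "real ^ 't ^ 'n" and U :: "real ^ 't ^ 'm"
    and \<sigma> :: "'n + 'm \<Rightarrow> 't"
    and Xt :: "real ^ ('n + 'm) ^ 'n" and Ut :: "real ^ ('n + 'm) ^ 'm"
  assumes "stabilizable A B"
    and "L = block_matrix Lxx Lxu (transpose Lxu) Luu"
    and "transpose L = L"
    and "positive_semidefinite L"
    and "positive_definite Luu"
    and "symmetric_bilinear_form_of \<beta> (quadratic_form L)"
    and "Xplus = A ** X + B ** U"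
    and "rank (stack X U) = CARD('n) + CARD('m)"
    and "inj \<sigma>"
    and "Xt = select_columns \<sigma> X"
    and "Ut = select_columns \<sigma> U"
    and "rank (stack Xt Ut) = CARD('n) + CARD('m)"
  shows "\<forall>(x :: real ^ 'n) (u :: real ^ 'm). \<exists>\<alpha> :: real ^ ('n + 'm).
           stage_cost L x u = \<alpha> \<bullet> (data_cost_matrix \<beta> (stack Xt Ut) *v \<alpha>)"
proof (intro allI)
  fix x :: "real ^ 'n" and u :: "real ^ 'm"
  have \<beta>: "bilinear \<beta>" "\<And>z. quadratic_form L z = \<beta> z z"
    using \<open>symmetric_bilinear_form_of \<beta> (quadratic_form L)\<close>
    by (simp_all add: symmetric_bilinear_form_of_def)
  have "surj ((*v) (stack Xt Ut))"
    using \<open>rank (stack Xt Ut) = CARD('n) + CARD('m)\<close>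
    by (simp flip: full_rank_surjective)
  then obtain \<alpha> where "stack x u = stack Xt Ut *v \<alpha>"
    by (rule surjE)
  then have "stage_cost L x u = \<alpha> \<bullet> (data_cost_matrix \<beta> (stack Xt Ut) *v \<alpha>)"
    by (simp add: stage_cost_def \<beta> bilinear_matrix_vector_mult_eq_data_cost_matrix)
  then show "\<exists>\<alpha> :: real ^ ('n + 'm).
      stage_cost L x u = \<alpha> \<bullet> (data_cost_matrix \<beta> (stack Xt Ut) *v \<alpha>)" ..
qed

end
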